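(* Assume that there exist at least three indices $j\in\{1,\dots,n\}$ with $\bar z^k_j\neq 0$ whose corresponding eigenvalues $\lambda_j$ are distinct. Then the three-step optimal step sizes, i.e. the optimal solutions $(\theta^k,\theta^{k+1},\theta^{k+2})$ of the three-step lookahead problem of minimizing $$\sum_{i=1}^N\left\|(I-\theta^{k+2}P)(I-\theta^{k+1}P)(I-\theta^kP)\left(z^k_\theta(x_i)-z^\star(x_i)\right)\right\|_2^2$$ over the scalars $\theta^k,\theta^{k+1},\theta^{k+2}$, can be found by finding the roots of a cubic equation. Any permutation of those roots is a solution, and the roots are all real-valued.
   Context: Let $P\in\mathbf{R}^{n\times n}$ be symmetric positive definite with eigendecomposition $P=Q\,\mathrm{diag}(\lambda)Q^T$, $Q$ orthogonal, $\lambda_1,\dots,\lambda_n>0$. For a parameter $x\in\mathbf{R}^n$ consider the problem of minimizing $(1/2)z^TPz+x^Tz$ over $z\in\mathbf{R}^n$, with solution $z^\star(x)=-P^{-1}x$. Given parameters $x_1,\dots,x_N\in\mathbf{R}^n$, an integer $k\ge0$, and previously fixed step sizes $\theta^0,\dots,\theta^{k-1}\in\mathbf{R}$, the points $z^k_\theta(x_i)$ are the gradient descent iterates $z^{l+1}_\theta(x)=z^l_\theta(x)-\theta^l(Pz^l_\theta(x)+x)$, $z^0_\theta(x)=0$; they are fixed data in the three-step lookahead problem. Define $$\bar z^k_j=\sum_{i=1}^N\left(Q^T(z^k_\theta(x_i)-z^\star(x_i))\right)_j^2\ge 0,\qquad j=1,\dots,n.$$ *)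

theory Defs
  imports "HOL-Analysis.Analysis" "HOL-Computational_Algebra.Computational_Algebra"
begin

definition diag_matrix :: "real ^ 'n \<Rightarrow> real ^ 'n ^ 'n" where
  "diag_matrix v = (\<chi> i j. if i = j then v $ i else 0)"

definition pos_def_matrix :: "real ^ 'n ^ 'n \<Rightarrow> bool" where
  "pos_def_matrix P \<longleftrightarrow> transpose P = P \<and> (\<forall>z. z \<noteq> 0 \<longrightarrow> z \<bullet> (P *v z) > 0)"

definition quad_solution :: "real ^ 'n ^ 'n \<Rightarrow> real ^ 'n \<Rightarrow> real ^ 'n" where
  "quad_solution P x = - (matrix_inv P *v x)"

primrec gd_iterate :: "real ^ 'n ^ 'n \<Rightarrow> (nat \<Rightarrow> real) \<Rightarrow> real ^ 'n \<Rightarrow> nat \<Rightarrow> real ^ 'n" where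
  "gd_iterate P \<theta> x 0 = 0"
| "gd_iterate P \<theta> x (Suc l) =
     gd_iterate P \<theta> x l - \<theta> l *\<^sub>R (P *v gd_iterate P \<theta> x l + x)"

definition gd_error :: "real ^ 'n ^ 'n \<Rightarrow> (nat \<Rightarrow> real) \<Rightarrow> nat \<Rightarrow> real ^ 'n \<Rightarrow> real ^ 'n" where
  "gd_error P \<theta> k x = gd_iterate P \<theta> x k - quad_solution P x"

definition zbar ::
  "real ^ 'n ^ 'n \<Rightarrow> real ^ 'n ^ 'n \<Rightarrow> (nat \<Rightarrow> real) \<Rightarrow> nat \<Rightarrow> nat \<Rightarrow> (nat \<Rightarrow> real ^ 'n) \<Rightarrow> real ^ 'n" where
  "zbar Q P \<theta> k N x = (\<chi> j. \<Sum>i=1..N. ((transpose Q *v gd_error P \<theta> k (x i)) $ j)\<^sup>2)"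

text \<open>Only the values of \<open>\<theta>\<close> below \<open>k\<close> enter the objective; the three decision
  variables \<open>\<theta>\<^sup>k\<close>, \<open>\<theta>\<^sup>k\<^sup>+\<^sup>1\<close>, \<open>\<theta>\<^sup>k\<^sup>+\<^sup>2\<close> are the components \<open>a\<close>, \<open>b\<close>, \<open>c\<close> of the last argument.\<close>

definition lookahead3_objective ::
  "real ^ 'n ^ 'n \<Rightarrow> (nat \<Rightarrow> real) \<Rightarrow> nat \<Rightarrow> nat \<Rightarrow> (nat \<Rightarrow> real ^ 'n) \<Rightarrow> real \<times> real \<times> real \<Rightarrow> real" where
  "lookahead3_objective P \<theta> k N x = (\<lambda>(a, b, c).
     \<Sum>i=1..N. (norm (((mat 1 - c *\<^sub>R P) ** (mat 1 - b *\<^sub>R P) ** (mat 1 - a *\<^sub>R P))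
                      *v gd_error P \<theta> k (x i)))\<^sup>2)"

definition lookahead3_optimal ::
  "real ^ 'n ^ 'n \<Rightarrow> (nat \<Rightarrow> real) \<Rightarrow> nat \<Rightarrow> nat \<Rightarrow> (nat \<Rightarrow> real ^ 'n) \<Rightarrow> real \<times> real \<times> real \<Rightarrow> bool" where
  "lookahead3_optimal P \<theta> k N x = is_arg_min (lookahead3_objective P \<theta> k N x) (\<lambda>_. True)"

text \<open>In the eigenbasis the objective is \<open>\<Sum>j. w\<^sub>j (1 - e\<^sub>1 \<lambda>\<^sub>j + e\<^sub>2 \<lambda>\<^sub>j\<^sup>2 - e\<^sub>3 \<lambda>\<^sub>j\<^sup>3)\<^sup>2\<close> with \<open>w = zbar\<close>
  and \<open>e\<^sub>1, e\<^sub>2, e\<^sub>3\<close> the elementary symmetric polynomials in the three step sizes.  With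
  \<open>m\<^sub>r = \<Sum>j. w\<^sub>j \<lambda>\<^sub>j\<^sup>r\<close>, the normal equations of this least-squares problem in \<open>(e\<^sub>1, e\<^sub>2, e\<^sub>3)\<close> are
  \<open>e\<^sub>1 m\<^sub>s\<^sub>+\<^sub>1 - e\<^sub>2 m\<^sub>s\<^sub>+\<^sub>2 + e\<^sub>3 m\<^sub>s\<^sub>+\<^sub>3 = m\<^sub>s\<close> for \<open>s = 1, 2, 3\<close>.  Solving them by Cramer's rule and
  multiplying \<open>t\<^sup>3 - e\<^sub>1 t\<^sup>2 + e\<^sub>2 t - e\<^sub>3\<close> by the determinant of the system gives the cubic below;
  its roots are candidates for the step sizes themselves (not for their reciprocals).\<close>

definition moment :: "real ^ 'n \<Rightarrow> real ^ 'n \<Rightarrow> nat \<Rightarrow> real" where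
  "moment lam w r = (\<Sum>j\<in>UNIV. w $ j * (lam $ j) ^ r)"

definition moment_det :: "real ^ 'n \<Rightarrow> real ^ 'n \<Rightarrow> nat \<Rightarrow> nat \<Rightarrow> nat \<Rightarrow> real" where
  "moment_det lam w p q r = (let m = moment lam w in
     det (vector [vector [m (1 + p), m (1 + q), m (1 + r)],
                  vector [m (2 + p), m (2 + q), m (2 + r)],
                  vector [m (3 + p), m (3 + q), m (3 + r)]] :: real ^ 3 ^ 3))"

definition lookahead3_cubic :: "real ^ 'n \<Rightarrow> real ^ 'n \<Rightarrow> real poly" where
  "lookahead3_cubic lam w =
     [:- moment_det lam w 0 1 2, moment_det lam w 0 1 3,
       - moment_det lam w 0 2 3, moment_det lam w 1 2 3:]"

end

theory Submission
  imports Defs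
begin

no_notation fps_nth (infixl \<open>$\<close> 75)

text \<open>In the eigenbasis of \<open>P\<close> the objective is a weighted least-squares functional of the
  polynomial \<open>q(\<lambda>) = (1 - a\<lambda>)(1 - b\<lambda>)(1 - c\<lambda>)\<close>, hence a quadratic in the elementary symmetric
  functions of \<open>a, b, c\<close>, strictly convex because there are three distinct atoms. Its unrestricted
  minimizer satisfies the normal equations, i.e. \<open>q\<close> is orthogonal to \<open>\<lambda>, \<lambda>\<^sup>2, \<lambda>\<^sup>3\<close>. Were a root
  of the associated cubic not real, then \<open>q(\<lambda>) = (1 - a\<lambda>)((1 - u\<lambda>)\<^sup>2 + v\<^sup>2\<lambda>\<^sup>2)\<close> with \<open>v \<noteq> 0\<close>, and
  pairing \<open>q\<close> with \<open>\<lambda>(1 - a\<lambda>)\<close> gives a positive number instead of \<open>0\<close>. So the unrestricted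
  minimizer comes from real step sizes.\<close>

section \<open>Definiteness of the weighted quadratic form\<close>

text \<open>Isolates the scalar problem from the matrices: \<open>lam\<close> holds the eigenvalues
  and \<open>w\<close> is later instantiated with \<open>zbar\<close>.\<close>

locale weighted_atoms =
  fixes lam w :: "real ^ 'n"
  assumes lam_pos: "lam $ j > 0"
    and w_nonneg: "w $ j \<ge> 0"
    and three_atoms: "\<exists>j1 j2 j3. w $ j1 \<noteq> 0 \<and> w $ j2 \<noteq> 0 \<and> w $ j3 \<noteq> 0
         \<and> lam $ j1 \<noteq> lam $ j2 \<and> lam $ j1 \<noteq> lam $ j3 \<and> lam $ j2 \<noteq> lam $ j3"
begin

text \<open>The relaxed objective: the three coefficients vary freely, whether or not they are
  elementary symmetric functions of real step sizes.\<close>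

definition residual :: "real \<Rightarrow> real \<Rightarrow> real \<Rightarrow> real" where
  "residual e1 e2 e3 =
     (\<Sum>j\<in>UNIV. w $ j * (1 - e1 * lam $ j + e2 * (lam $ j)^2 - e3 * (lam $ j)^3)\<^sup>2)"

text \<open>After division by the positive \<open>lam $ j\<close>, a polynomial of degree at most
  two vanishes at three distinct points. This yields both the nonsingular normal equations and the
  unique minimizer.\<close>

lemma vanishing_square_sum:
  assumes "(\<Sum>j\<in>UNIV. w $ j * (d1 * lam $ j + d2 * (lam $ j)^2 + d3 * (lam $ j)^3)\<^sup>2) = 0"
  shows "d1 = 0 \<and> d2 = 0 \<and> d3 = 0"
proof -
  have root: "d1 + d2 * lam $ j + d3 * (lam $ j)^2 = 0" if "w $ j \<noteq> 0" for j
  proof -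
    have "w $ j * (d1 * lam $ j + d2 * (lam $ j)^2 + d3 * (lam $ j)^3)\<^sup>2 = 0"
      using assms w_nonneg by (subst (asm) sum_nonneg_eq_0_iff) auto
    hence "d1 * lam $ j + d2 * (lam $ j)^2 + d3 * (lam $ j)^3 = 0"
      using that by simp
    hence "lam $ j * (d1 + d2 * lam $ j + d3 * (lam $ j)^2) = 0" by algebra
    thus ?thesis using lam_pos[of j] by simp
  qed
  obtain j1 j2 j3 where w: "w $ j1 \<noteq> 0" "w $ j2 \<noteq> 0" "w $ j3 \<noteq> 0"
    and ne: "lam $ j1 \<noteq> lam $ j2" "lam $ j1 \<noteq> lam $ j3" "lam $ j2 \<noteq> lam $ j3"
    using three_atoms by blast
  let ?x = "lam $ j1" and ?y = "lam $ j2" and ?z = "lam $ j3"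
  note r = root[OF w(1)] root[OF w(2)] root[OF w(3)]
  \<comment> \<open>Successive divided differences strip off first \<open>d1\<close>, then
    \<open>d2\<close>.\<close>
  have "(?x - ?y) * (d2 + d3 * (?x + ?y)) = 0" using r(1,2) by algebra
  hence xy: "d2 + d3 * (?x + ?y) = 0" using ne(1) by simp
  have "(?x - ?z) * (d2 + d3 * (?x + ?z)) = 0" using r(1,3) by algebra
  hence xz: "d2 + d3 * (?x + ?z) = 0" using ne(2) by simp
  have "(?y - ?z) * d3 = 0" using xy xz by algebra
  hence "d3 = 0" using ne(3) by simp
  thus ?thesis using xy r(1) by simp
qed

lemma moment_linear3:
  "d1 * moment lam w (r + 1) + d2 * moment lam w (r + 2) + d3 * moment lam w (r + 3)
     = (\<Sum>j\<in>UNIV. w $ j * (lam $ j)^r * (d1 * lam $ j + d2 * (lam $ j)^2 + d3 * (lam $ j)^3))"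
  unfolding moment_def sum_distrib_left sum.distrib[symmetric]
  by (intro sum.cong) (simp_all add: algebra_simps power_add power2_eq_square power3_eq_cube)

text \<open>The matrix is the Gram matrix of \<lambda>, \<lambda>^2, \<lambda>^3 in the
  \<open>w\<close>-weighted inner product, so a kernel vector has vanishing weighted norm.\<close>

lemma moment_det_nz: "moment_det lam w 1 2 3 \<noteq> 0"
proof -
  let ?m = "moment lam w"
  let ?A = "vector [vector [?m 2, ?m 3, ?m 4], vector [?m 3, ?m 4, ?m 5],
                    vector [?m 4, ?m 5, ?m 6]] :: real ^ 3 ^ 3"
  have "d = 0" if "?A *v d = 0" for d :: "real ^ 3"
  proof -
    have "(?A *v d) $ 1 = 0" "(?A *v d) $ 2 = 0" "(?A *v d) $ 3 = 0"
      using that by simp_all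
    hence eqs: "?m 2 * d $ 1 + ?m 3 * d $ 2 + ?m 4 * d $ 3 = 0"
      "?m 3 * d $ 1 + ?m 4 * d $ 2 + ?m 5 * d $ 3 = 0"
      "?m 4 * d $ 1 + ?m 5 * d $ 2 + ?m 6 * d $ 3 = 0"
      by (simp_all add: matrix_vector_mult_def sum_3)
    \<comment> \<open>This is the quadratic form of \<open>?A\<close> at \<open>d\<close>; the
      indices stay unevaluated so that \<open>moment_linear3\<close> matches.\<close>
    have "(\<Sum>j\<in>UNIV. w $ j * (d $ 1 * lam $ j + d $ 2 * (lam $ j)^2 + d $ 3 * (lam $ j)^3)\<^sup>2)
      = d $ 1 * (d $ 1 * ?m (1 + 1) + d $ 2 * ?m (1 + 2) + d $ 3 * ?m (1 + 3))
      + d $ 2 * (d $ 1 * ?m (2 + 1) + d $ 2 * ?m (2 + 2) + d $ 3 * ?m (2 + 3))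
      + d $ 3 * (d $ 1 * ?m (3 + 1) + d $ 2 * ?m (3 + 2) + d $ 3 * ?m (3 + 3))"
      unfolding moment_linear3 unfolding sum_distrib_left sum.distrib[symmetric]
      by (intro sum.cong) (simp_all add: algebra_simps power2_eq_square power3_eq_cube)
    also have "\<dots> = 0" using eqs by (simp add: numeral_eq_Suc mult.commute)
    finally have "d $ 1 = 0 \<and> d $ 2 = 0 \<and> d $ 3 = 0" by (rule vanishing_square_sum)
    thus ?thesis by (simp add: vec_eq_iff forall_3)
  qed
  hence "det ?A \<noteq> 0"
    by (metis invertible_det_nz invertible_left_inverse matrix_left_invertible_ker)
  thus ?thesis by (simp add: moment_det_def Let_def numeral_eq_Suc)
qed

section \<open>Normal equations and the relaxed minimizer\<close>

text \<open>Cramer quotients with the replaced column moved to the front; the sign of that move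
  cancels the minus sign of the second unknown.\<close>

definition "opt_e1 = moment_det lam w 0 2 3 / moment_det lam w 1 2 3"
definition "opt_e2 = moment_det lam w 0 1 3 / moment_det lam w 1 2 3"
definition "opt_e3 = moment_det lam w 0 1 2 / moment_det lam w 1 2 3"

lemma cubic_eq:
  "lookahead3_cubic lam w = smult (moment_det lam w 1 2 3) [:- opt_e3, opt_e2, - opt_e1, 1:]"
  using moment_det_nz
  by (simp add: lookahead3_cubic_def opt_e1_def opt_e2_def opt_e3_def)

text \<open>With denominators cleared, this is the Laplace expansion of a 4 by 4 determinant along
  its first row, which repeats row \<open>s\<close> of the other three.\<close>

lemma normal_equations:
  assumes "s \<in> {1, 2, 3}"
  shows "opt_e1 * moment lam w (s + 1) - opt_e2 * moment lam w (s + 2)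
     + opt_e3 * moment lam w (s + 3) = moment lam w s"
proof -
  let ?m = "moment lam w"
  have "moment_det lam w 0 2 3 * ?m (s + 1) - moment_det lam w 0 1 3 * ?m (s + 2)
     + moment_det lam w 0 1 2 * ?m (s + 3) = moment_det lam w 1 2 3 * ?m s"
    using assms by (auto simp: moment_det_def det_3 Let_def algebra_simps eval_nat_numeral)
  thus ?thesis
    using moment_det_nz unfolding opt_e1_def opt_e2_def opt_e3_def
    by (simp add: field_simps)
qed

text \<open>The normal equations in geometric form. The coefficients are arbitrary because the
  decomposition of \<open>residual\<close> and the real-root argument use different test
  polynomials.\<close>

lemma opt_orthogonal:
  "(\<Sum>j\<in>UNIV. w $ j * (1 - opt_e1 * lam $ j + opt_e2 * (lam $ j)^2 - opt_e3 * (lam $ j)^3)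
      * (d1 * lam $ j + d2 * (lam $ j)^2 + d3 * (lam $ j)^3)) = 0"
proof -
  let ?m = "moment lam w"
  have *: "(\<Sum>j\<in>UNIV. w $ j * (lam $ j)^s *
      (1 - opt_e1 * lam $ j + opt_e2 * (lam $ j)^2 - opt_e3 * (lam $ j)^3)) = 0"
    if "s \<in> {1, 2, 3}" for s
  proof -
    have "(\<Sum>j\<in>UNIV. w $ j * (lam $ j)^s *
      (1 - opt_e1 * lam $ j + opt_e2 * (lam $ j)^2 - opt_e3 * (lam $ j)^3))
      = ?m s - (opt_e1 * ?m (s + 1) + (- opt_e2) * ?m (s + 2) + opt_e3 * ?m (s + 3))"
      unfolding moment_linear3 unfolding moment_def sum_subtractf[symmetric]
      by (intro sum.cong) (simp_all add: algebra_simps)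
    thus ?thesis using normal_equations[OF that] by simp
  qed
  have "(\<Sum>j\<in>UNIV. w $ j * (1 - opt_e1 * lam $ j + opt_e2 * (lam $ j)^2 - opt_e3 * (lam $ j)^3)
      * (d1 * lam $ j + d2 * (lam $ j)^2 + d3 * (lam $ j)^3))
    = (\<Sum>s\<in>{1,2,3}. (if s = 1 then d1 else if s = 2 then d2 else d3) *
        (\<Sum>j\<in>UNIV. w $ j * (lam $ j)^s *
          (1 - opt_e1 * lam $ j + opt_e2 * (lam $ j)^2 - opt_e3 * (lam $ j)^3)))"
    unfolding sum_distrib_left by (subst sum.swap) (intro sum.cong; simp add: algebra_simps)
  also have "\<dots> = 0"
    by (intro sum.neutral ballI) (simp only: * mult_zero_right)
  finally show ?thesis .
qed

text \<open>Pythagoras: the cross term of the expanded square vanishes by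
  \<open>opt_orthogonal\<close>.\<close>

lemma residual_decomposition:
  "residual e1 e2 e3 = residual opt_e1 opt_e2 opt_e3 +
    (\<Sum>j\<in>UNIV. w $ j * ((opt_e1 - e1) * lam $ j + (e2 - opt_e2) * (lam $ j)^2
       + (opt_e3 - e3) * (lam $ j)^3)\<^sup>2)"
proof -
  have "residual e1 e2 e3 = residual opt_e1 opt_e2 opt_e3 +
    (\<Sum>j\<in>UNIV. w $ j * ((opt_e1 - e1) * lam $ j + (e2 - opt_e2) * (lam $ j)^2
       + (opt_e3 - e3) * (lam $ j)^3)\<^sup>2) +
    2 * (\<Sum>j\<in>UNIV. w $ j * (1 - opt_e1 * lam $ j + opt_e2 * (lam $ j)^2 - opt_e3 * (lam $ j)^3)
      * ((opt_e1 - e1) * lam $ j + (e2 - opt_e2) * (lam $ j)^2 + (opt_e3 - e3) * (lam $ j)^3))"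
    unfolding residual_def sum_distrib_left sum.distrib[symmetric]
    by (intro sum.cong refl) algebra
  thus ?thesis by (simp add: opt_orthogonal)
qed

lemma residual_ge: "residual opt_e1 opt_e2 opt_e3 \<le> residual e1 e2 e3"
  by (subst residual_decomposition[of e1]) (simp add: sum_nonneg w_nonneg)

lemma residual_unique:
  assumes "residual e1 e2 e3 \<le> residual opt_e1 opt_e2 opt_e3"
  shows "e1 = opt_e1 \<and> e2 = opt_e2 \<and> e3 = opt_e3"
proof -
  let ?S = "\<Sum>j\<in>UNIV. w $ j * ((opt_e1 - e1) * lam $ j + (e2 - opt_e2) * (lam $ j)^2
       + (opt_e3 - e3) * (lam $ j)^3)\<^sup>2"
  have "?S \<ge> 0" by (simp add: sum_nonneg w_nonneg)
  with assms have "?S = 0" by (subst (asm) residual_decomposition) simp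
  from vanishing_square_sum[OF this] show ?thesis by simp
qed

section \<open>Real roots and attainment by real step sizes\<close>

lemma opt_cubic_real_root:
  fixes t :: complex
  assumes "t^3 - of_real opt_e1 * t^2 + of_real opt_e2 * t - of_real opt_e3 = 0"
  shows "t \<in> \<real>"
proof (rule ccontr)
  assume nonreal: "t \<notin> \<real>"
  define u v where "u = Re t" and "v = Im t"
  have v: "v \<noteq> 0" using nonreal by (simp add: v_def complex_is_Real_iff)
  \<comment> \<open>By Vieta, the third root beside \<open>t\<close> and its conjugate.\<close>
  define a where "a = opt_e1 - 2 * u"
  have re: "u^3 - 3 * u * v^2 - opt_e1 * (u^2 - v^2) + opt_e2 * u - opt_e3 = 0"
    using arg_cong[OF assms, of Re]
    by (simp add: u_def v_def power2_eq_square power3_eq_cube algebra_simps)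
  have "v * (3 * u^2 - v^2 - 2 * opt_e1 * u + opt_e2) = 0"
    using arg_cong[OF assms, of Im]
    by (simp add: u_def v_def power2_eq_square power3_eq_cube algebra_simps)
  with v have im: "3 * u^2 - v^2 - 2 * opt_e1 * u + opt_e2 = 0" by simp
  \<comment> \<open>For \<open>l\<close> nonzero the left side is \<open>l^3\<close> times the monic
    cubic at \<open>1 / l\<close>, so a root \<open>r\<close> gives the factor
    \<open>1 - r * l\<close>; the conjugate pair merges into the sum of squares.\<close>
  have factor: "1 - opt_e1 * l + opt_e2 * l^2 - opt_e3 * l^3
      = (1 - a * l) * ((1 - u * l)^2 + v^2 * l^2)" for l
    using re im unfolding a_def by algebra
  let ?f = "\<lambda>j. w $ j * (lam $ j * (1 - a * lam $ j)\<^sup>2 * ((1 - u * lam $ j)^2 + v^2 * (lam $ j)^2))"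
  have "(\<Sum>j\<in>UNIV. ?f j) = (\<Sum>j\<in>UNIV. w $ j *
      (1 - opt_e1 * lam $ j + opt_e2 * (lam $ j)^2 - opt_e3 * (lam $ j)^3)
      * (1 * lam $ j + (- a) * (lam $ j)^2 + 0 * (lam $ j)^3))"
    unfolding factor by (intro sum.cong refl) algebra
  also have "\<dots> = 0" by (rule opt_orthogonal)
  finally have sum0: "(\<Sum>j\<in>UNIV. ?f j) = 0" .
  have "?f j \<ge> 0" for j
    using w_nonneg[of j] lam_pos[of j] by (intro mult_nonneg_nonneg add_nonneg_nonneg) auto
  hence f0: "?f j = 0" for j
    using sum0 by (subst (asm) sum_nonneg_eq_0_iff) auto
  \<comment> \<open>The sum of squares is positive, so every atom with nonzero weight would have to
    sit at the single point \<open>1 / a\<close>.\<close>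
  have al: "a * lam $ j = 1" if "w $ j \<noteq> 0" for j
  proof -
    have "v^2 * (lam $ j)^2 > 0" using v lam_pos[of j] by simp
    hence "(1 - u * lam $ j)^2 + v^2 * (lam $ j)^2 \<noteq> 0"
      using zero_le_power2[of "1 - u * lam $ j"] by linarith
    thus ?thesis using f0[of j] that lam_pos[of j] by simp
  qed
  obtain j1 j2 where "w $ j1 \<noteq> 0" "w $ j2 \<noteq> 0" "lam $ j1 \<noteq> lam $ j2"
    using three_atoms by blast
  thus False using al[of j1] al[of j2] by (metis mult_cancel_left mult_zero_left zero_neq_one)
qed

lemma poly_cubic_eq_0_iff:
  "poly (map_poly complex_of_real (lookahead3_cubic lam w)) t = 0 \<longleftrightarrow>
     t^3 - of_real opt_e1 * t^2 + of_real opt_e2 * t - of_real opt_e3 = 0"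
proof -
  have "poly (map_poly complex_of_real (lookahead3_cubic lam w)) t
     = of_real (moment_det lam w 1 2 3) *
       (t^3 - of_real opt_e1 * t^2 + of_real opt_e2 * t - of_real opt_e3)"
    unfolding cubic_eq by (simp add: map_poly_pCons power2_eq_square power3_eq_cube algebra_simps)
  thus ?thesis using moment_det_nz by simp
qed

lemma degree_cubic: "degree (map_poly complex_of_real (lookahead3_cubic lam w)) = 3"
  using moment_det_nz by (simp add: lookahead3_cubic_def map_poly_pCons)

text \<open>Vieta with multiplicity, by comparing coefficients with the product of linear factors.
  The multiset makes the statement independent of the order of the step sizes.\<close>

lemma proots_cubic_iff:
  fixes a b c :: real
  shows "{#complex_of_real a, complex_of_real b, complex_of_real c#}
       = proots (map_poly complex_of_real (lookahead3_cubic lam w)) \<longleftrightarrow>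
     a + b + c = opt_e1 \<and> a * b + a * c + b * c = opt_e2 \<and> a * b * c = opt_e3"
    (is "?A = proots ?p \<longleftrightarrow> ?E")
proof
  let ?D = "moment_det lam w 1 2 3"
  have p: "?p = smult (of_real ?D)
      [:- of_real opt_e3, of_real opt_e2, - of_real opt_e1, 1:]"
    unfolding cubic_eq by (simp add: map_poly_pCons)
  have D: "complex_of_real ?D \<noteq> 0" using moment_det_nz by simp
  have prod: "(\<Prod>x\<in>#?A. [:- x, 1:]) = [:- of_real (a * b * c),
      of_real (a * b + a * c + b * c), - of_real (a + b + c), 1:]"
    by (simp add: algebra_simps)
  show ?E if "?A = proots ?p"
  proof -
    have "smult (lead_coeff ?p) (\<Prod>x\<in>#?A. [:- x, 1:]) = ?p"
      unfolding that by (rule complex_poly_decompose_multiset)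
    moreover have "lead_coeff ?p = of_real ?D" unfolding p by simp
    ultimately have "smult (of_real ?D) (\<Prod>x\<in>#?A. [:- x, 1:]) = smult (of_real ?D)
      [:- of_real opt_e3, of_real opt_e2, - of_real opt_e1, 1:]"
      by (metis p)
    hence "(\<Prod>x\<in>#?A. [:- x, 1:]) = [:- complex_of_real opt_e3, of_real opt_e2, - of_real opt_e1, 1:]"
      using D by (metis smult_cancel)
    thus ?E unfolding prod
      by (simp del: of_real_mult of_real_add)
  qed
  show "?A = proots ?p" if ?E
  proof -
    have "?p = smult (of_real ?D) (\<Prod>x\<in>#?A. [:- x, 1:])"
      unfolding p prod using that by simp
    also have "\<dots> = smult (of_real ?D)
        ([:- of_real a, 1:] * ([:- of_real b, 1:] * [:- of_real c, 1:]))"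
      by (simp only: image_mset_add_mset image_mset_empty prod_mset.add_mset
          prod_mset.empty mult_1_right)
    finally have "proots ?p = proots (smult (of_real ?D)
        ([:- of_real a, 1:] * ([:- of_real b, 1:] * [:- of_real c, 1:])))"
      by (rule arg_cong)
    also have "\<dots> = proots ([:- of_real a, 1:] * ([:- of_real b, 1:] * [:- of_real c, 1:]))"
      by (rule proots_smult[OF D])
    also have "\<dots> = ?A"
      by (subst proots_mult; (subst proots_mult)?; (simp only: mult_eq_0_iff pCons_eq_0_iff)?; simp)
    finally show ?thesis by simp
  qed
qed

text \<open>The relaxation is tight: over the complex numbers the cubic has three roots with
  multiplicity, and all of them are real.\<close>

lemma opt_attained:
  obtains a b c where "a + b + c = opt_e1" "a * b + a * c + b * c = opt_e2" "a * b * c = opt_e3"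
proof -
  let ?p = "map_poly complex_of_real (lookahead3_cubic lam w)"
  obtain xs where xs: "mset xs = proots ?p" using ex_mset by blast
  hence "length xs = 3" by (metis size_mset size_proots_complex degree_cubic)
  then obtain r s t where "xs = [r, s, t]" by (auto simp: numeral_3_eq_3 length_Suc_conv)
  with xs have rst: "proots ?p = {#r, s, t#}" by simp
  have "?p \<noteq> 0" using degree_cubic by auto
  hence "poly ?p y = 0" if "y \<in># proots ?p" for y using that by simp
  hence "y \<in> \<real>" if "y \<in># proots ?p" for y
    using that opt_cubic_real_root poly_cubic_eq_0_iff by blast
  hence "r \<in> \<real>" "s \<in> \<real>" "t \<in> \<real>" unfolding rst by auto
  then obtain a b c where "r = of_real a" "s = of_real b" "t = of_real c"
    by (auto elim!: Reals_cases)
  thus ?thesis using rst proots_cubic_iff[of a b c] that[of a b c] by simp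
qed

lemma residual_arg_min_iff:
  "is_arg_min (\<lambda>(a, b, c). residual (a + b + c) (a * b + a * c + b * c) (a * b * c)) (\<lambda>_. True) (a, b, c)
   \<longleftrightarrow> a + b + c = opt_e1 \<and> a * b + a * c + b * c = opt_e2 \<and> a * b * c = opt_e3"
proof
  assume *: "is_arg_min (\<lambda>(a, b, c). residual (a + b + c) (a * b + a * c + b * c) (a * b * c))
    (\<lambda>_. True) (a, b, c)"
  \<comment> \<open>A real triple attaining the relaxed minimum; comparison with it brings any
    optimal triple down to that value.\<close>
  obtain a' b' c' where e: "a' + b' + c' = opt_e1" "a' * b' + a' * c' + b' * c' = opt_e2"
    "a' * b' * c' = opt_e3" by (rule opt_attained)
  have "residual (a + b + c) (a * b + a * c + b * c) (a * b * c)
      \<le> residual (a' + b' + c') (a' * b' + a' * c' + b' * c') (a' * b' * c')"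
    using * by (simp add: is_arg_min_linorder)
  hence "residual (a + b + c) (a * b + a * c + b * c) (a * b * c)
      \<le> residual opt_e1 opt_e2 opt_e3"
    unfolding e .
  thus "a + b + c = opt_e1 \<and> a * b + a * c + b * c = opt_e2 \<and> a * b * c = opt_e3"
    by (rule residual_unique)
qed (auto simp: is_arg_min_linorder residual_ge)

end

section \<open>Reduction to the eigenbasis\<close>

lemma diag_matrix_vector_mult: "(diag_matrix v *v y) $ j = v $ j * y $ j"
  by (simp add: diag_matrix_def matrix_vector_mult_def if_distrib if_distribR cong: if_cong)

lemma eigenbasis_step:
  fixes Q :: "real ^ 'n ^ 'n"
  assumes "orthogonal_matrix Q" "P = Q ** diag_matrix lam ** transpose Q"
  shows "(transpose Q *v ((mat 1 - s *\<^sub>R P) *v y)) $ j = (1 - s * lam $ j) * (transpose Q *v y) $ j"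
proof -
  have "transpose Q *v (P *v y) = (transpose Q ** Q) *v (diag_matrix lam *v (transpose Q *v y))"
    by (simp add: assms(2) matrix_vector_mul_assoc matrix_mul_assoc del: transpose_matrix_vector)
  also have "transpose Q ** Q = mat 1" using assms(1) by (simp add: orthogonal_matrix_def)
  finally have "(transpose Q *v (P *v y)) $ j = lam $ j * (transpose Q *v y) $ j"
    by (simp add: diag_matrix_vector_mult del: transpose_matrix_vector)
  thus ?thesis
    by (simp del: transpose_matrix_vector add: matrix_vector_mult_diff_rdistrib matrix_vector_mult_diff_distrib
        scaleR_matrix_vector_assoc[symmetric] matrix_vector_mult_scaleR algebra_simps)
qed

lemma norm_sq_orthogonal_transpose:
  fixes Q :: "real ^ 'n ^ 'n"
  assumes "orthogonal_matrix Q"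
  shows "(norm y)\<^sup>2 = (\<Sum>j\<in>UNIV. ((transpose Q *v y) $ j)\<^sup>2)"
proof -
  have "(norm (transpose Q *v y))\<^sup>2 = y \<bullet> (Q *v (transpose Q *v y))"
    by (simp only: power2_norm_eq_inner transpose_matrix_vector dot_lmul_matrix)
  also have "\<dots> = (norm y)\<^sup>2"
    using assms by (simp add: power2_norm_eq_inner matrix_vector_mul_assoc orthogonal_matrix_def
        del: transpose_matrix_vector)
  finally have "(norm y)\<^sup>2 = (norm (transpose Q *v y))\<^sup>2" ..
  also have "\<dots> = (\<Sum>j\<in>UNIV. ((transpose Q *v y) $ j)\<^sup>2)"
    by (simp add: power2_norm_eq_inner inner_vec_def flip: power2_eq_square)
  finally show ?thesis .
qed

text \<open>Each step scales coordinate \<open>j\<close> by its own scalar factor, so exchanging the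
  two sums collects the squared initial coordinates into \<open>zbar\<close>.\<close>

lemma lookahead3_objective_eigenbasis:
  fixes Q :: "real ^ 'n ^ 'n"
  assumes "orthogonal_matrix Q" "P = Q ** diag_matrix lam ** transpose Q"
  shows "lookahead3_objective P \<theta> k N x (a, b, c) = (\<Sum>j\<in>UNIV. zbar Q P \<theta> k N x $ j *
      (1 - (a + b + c) * lam $ j + (a * b + a * c + b * c) * (lam $ j)^2 - a * b * c * (lam $ j)^3)\<^sup>2)"
proof -
  have "lookahead3_objective P \<theta> k N x (a, b, c) = (\<Sum>i=1..N. \<Sum>j\<in>UNIV.
      ((1 - c * lam $ j) * ((1 - b * lam $ j) * ((1 - a * lam $ j)
        * (transpose Q *v gd_error P \<theta> k (x i)) $ j)))\<^sup>2)"
    by (simp add: lookahead3_objective_def norm_sq_orthogonal_transpose[OF assms(1)]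
        matrix_vector_mul_assoc[symmetric] eigenbasis_step[OF assms] del: transpose_matrix_vector)
  also have "\<dots> = (\<Sum>j\<in>UNIV. \<Sum>i=1..N. ((transpose Q *v gd_error P \<theta> k (x i)) $ j)\<^sup>2 *
      (1 - (a + b + c) * lam $ j + (a * b + a * c + b * c) * (lam $ j)^2 - a * b * c * (lam $ j)^3)\<^sup>2)"
    by (subst sum.swap) (intro sum.cong refl, algebra)
  finally show ?thesis by (simp add: zbar_def sum_distrib_right)
qed

theorem theorem5:
  fixes P Q :: "real ^ 'n ^ 'n"
    and lam :: "real ^ 'n"
    and x :: "nat \<Rightarrow> real ^ 'n"
    and N k :: nat
    and \<theta> :: "nat \<Rightarrow> real"
  assumes P_pos_def: "pos_def_matrix P"
    and Q_orthogonal: "orthogonal_matrix Q"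
    and lam_pos: "\<And>j. lam $ j > 0"
    and eigendecomposition: "P = Q ** diag_matrix lam ** transpose Q"
    and three_distinct:
      "\<exists>j1 j2 j3. zbar Q P \<theta> k N x $ j1 \<noteq> 0 \<and> zbar Q P \<theta> k N x $ j2 \<noteq> 0 \<and> zbar Q P \<theta> k N x $ j3 \<noteq> 0
         \<and> lam $ j1 \<noteq> lam $ j2 \<and> lam $ j1 \<noteq> lam $ j3 \<and> lam $ j2 \<noteq> lam $ j3"
  defines "p \<equiv> map_poly complex_of_real (lookahead3_cubic lam (zbar Q P \<theta> k N x))"
  shows "degree p = 3
    \<and> (\<forall>t. poly p t = 0 \<longrightarrow> t \<in> \<real>)
    \<and> (\<forall>a b c. lookahead3_optimal P \<theta> k N x (a, b, c) \<longleftrightarrow>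
          {#complex_of_real a, complex_of_real b, complex_of_real c#} = proots p)"
proof -
  interpret weighted_atoms lam "zbar Q P \<theta> k N x"
    using lam_pos three_distinct by unfold_locales (simp_all add: zbar_def sum_nonneg)
  \<comment> \<open>An equality of functions, so that \<open>is_arg_min\<close> transfers by
    rewriting.\<close>
  have "lookahead3_objective P \<theta> k N x =
      (\<lambda>(a, b, c). residual (a + b + c) (a * b + a * c + b * c) (a * b * c))"
    by (auto simp: lookahead3_objective_eigenbasis[OF Q_orthogonal eigendecomposition] residual_def)
  thus ?thesis
    unfolding p_def lookahead3_optimal_def
    using degree_cubic opt_cubic_real_root poly_cubic_eq_0_iff residual_arg_min_iff proots_cubic_iff
    by simp
qed

end
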